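(* Let $(\mathbb{U},\rho)$ be the Urysohn space. Then there is a comeager set $\mathcal{G}\subseteq\mathcal{F}(\mathbb{U})$ such that for every $F\in\mathcal{G}$, the set of isometries $f\in\mathrm{Iso}(F)$ that extend to an isometry of $\mathbb{U}$ is meager in $\mathrm{Iso}(F)$. Moreover, there is a comeager set $\mathcal{G}_2\subseteq\mathcal{F}(\mathbb{U})\times\mathcal{F}(\mathbb{U})$ such that for every $(A,B)\in\mathcal{G}_2$, the set of isometries $f\in\mathrm{Iso}(A,B)$ that extend to an isometry of $\mathbb{U}$ is meager in $\mathrm{Iso}(A,B)$.
   Context: The Urysohn space $(\mathbb{U},\rho)$ is the unique (up to isometry) Polish metric space that is ultrahomogeneous (every isometry between finite subspaces extends to an isometry of $\mathbb{U}$) and universal for Polish metric spaces. $\mathcal{F}(\mathbb{U})$ is the set of closed subsets of $\mathbb{U}$ with the Wijsman topology, the weakest topology making all maps $F\mapsto\rho(x,F)$, $x\in\mathbb{U}$, continuous (a Polish topology). For metric spaces $A,B$, $\mathrm{Iso}(A,B)$ is the space of bijective isometries $A\to B$ with the pointwise convergence topology, and $\mathrm{Iso}(A)=\mathrm{Iso}(A,A)$. *)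

theory Defs
  imports "HOL-Analysis.Analysis"
begin

section \<open>Baire category in a topological space\<close>

definition nowhere_dense_in :: "'a topology \<Rightarrow> 'a set \<Rightarrow> bool" where
  "nowhere_dense_in X S \<longleftrightarrow> S \<subseteq> topspace X \<and> X interior_of (X closure_of S) = {}"

definition meager_in :: "'a topology \<Rightarrow> 'a set \<Rightarrow> bool" where
  "meager_in X S \<longleftrightarrow> (\<exists>\<N>. countable \<N> \<and> (\<forall>N\<in>\<N>. nowhere_dense_in X N) \<and> S = \<Union>\<N>)"

definition comeager_in :: "'a topology \<Rightarrow> 'a set \<Rightarrow> bool" where
  "comeager_in X S \<longleftrightarrow> S \<subseteq> topspace X \<and> meager_in X (topspace X - S)"


section \<open>Isometries\<close>

text \<open>Maps are taken extensional, so that each map with domain \<open>A\<close> is represented by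
  exactly one function on the ambient type.  For \<open>A = UNIV\<close> this is no restriction.\<close>

definition Iso :: "'a::metric_space set \<Rightarrow> 'b::metric_space set \<Rightarrow> ('a \<Rightarrow> 'b) set" where
  "Iso A B = {f \<in> extensional A. bij_betw f A B \<and> (\<forall>x\<in>A. \<forall>y\<in>A. dist (f x) (f y) = dist x y)}"

text \<open>Pointwise convergence on \<open>A\<close> is the product topology indexed by \<open>A\<close>.\<close>

definition Iso_topology :: "'a::metric_space set \<Rightarrow> 'b::metric_space set \<Rightarrow> ('a \<Rightarrow> 'b) topology" where
  "Iso_topology A B = subtopology (product_topology (\<lambda>_. euclidean) A) (Iso A B)"

definition extends_to_isometry :: "'a::metric_space set \<Rightarrow> ('a \<Rightarrow> 'a) \<Rightarrow> bool" where
  "extends_to_isometry A f \<longleftrightarrow> (\<exists>g\<in>Iso UNIV UNIV. \<forall>x\<in>A. g x = f x)"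


section \<open>The Urysohn space\<close>

definition ultrahomogeneous :: "'a::metric_space itself \<Rightarrow> bool" where
  "ultrahomogeneous _ \<longleftrightarrow>
     (\<forall>(A::'a set) B. \<forall>f\<in>Iso A B. finite A \<longrightarrow> extends_to_isometry A f)"

text \<open>A Polish metric space has at most the cardinality of the continuum, so up to isometry every
  Polish metric space (of any type) has its points in \<^typ>\<open>real\<close>.  The carrier \<open>mspace m\<close> is an
  arbitrary set of reals and \<open>mdist m\<close> an arbitrary metric on it, unrelated to the usual one.\<close>

definition universal_Polish :: "'a::metric_space itself \<Rightarrow> bool" where
  "universal_Polish _ \<longleftrightarrow>
     (\<forall>m :: real metric. mcomplete_of m \<and> separable_space (mtopology_of m) \<longrightarrow>
        (\<exists>e :: real \<Rightarrow> 'a. \<forall>x\<in>mspace m. \<forall>y\<in>mspace m. dist (e x) (e y) = mdist m x y))"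

definition Urysohn_space :: "'a::polish_space itself \<Rightarrow> bool" where
  "Urysohn_space T \<longleftrightarrow> ultrahomogeneous T \<and> universal_Polish T"


section \<open>The Wijsman topology\<close>

text \<open>Distance to a set, with value \<open>\<infinity>\<close> for the empty set.  The library's \<^const>\<open>infdist\<close>
  has \<open>infdist x {} = 0\<close>, which would make the closed sets \<open>{}\<close> and \<open>UNIV\<close>
  topologically indistinguishable below.\<close>

definition dist_to_set :: "'a::metric_space \<Rightarrow> 'a set \<Rightarrow> ereal" where
  "dist_to_set x F = (INF y\<in>F. ereal (dist x y))"

text \<open>The weakest topology on the closed sets (including the empty set) for which every
  map \<open>F \<mapsto> dist_to_set x F\<close> is continuous.\<close>

definition Wijsman :: "'a::metric_space set topology" where
  "Wijsman = topology_generated_by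
     {{F. closed F \<and> dist_to_set x F \<in> V} |x V. open V}"

lemma topspace_Wijsman [simp]: "topspace Wijsman = {F. closed F}"
  unfolding Wijsman_def topology_generated_by_topspace by blast

lemma topspace_Iso_topology [simp]: "topspace (Iso_topology A B) = Iso A B"
  by (auto simp: Iso_topology_def Iso_def PiE_def)

lemma dist_to_set_eq_infdist:
  assumes "F \<noteq> {}"
  shows "dist_to_set x F = ereal (infdist x F)"
proof (rule antisym)
  show "ereal (infdist x F) \<le> dist_to_set x F"
    unfolding dist_to_set_def by (auto intro!: INF_greatest infdist_le)
  show "dist_to_set x F \<le> ereal (infdist x F)"
  proof (rule ereal_le_epsilon2)
    fix e :: real assume "0 < e"
    then have "infdist x F < infdist x F + e" by simp
    then obtain y where y: "y \<in> F" "dist x y < infdist x F + e"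
      using assms cINF_less_iff[of F "dist x" "infdist x F + e"]
      by (auto simp: infdist_notempty)
    have "dist_to_set x F \<le> ereal (dist x y)"
      unfolding dist_to_set_def using y(1) by (rule INF_lower)
    with y(2) show "dist_to_set x F \<le> ereal (infdist x F) + ereal e"
      by (smt (verit) ereal_less_eq(3) order_trans plus_ereal.simps(1))
  qed
qed

end

theory Submission
  imports Defs
begin

text \<open>
  A generic closed set \<open>A\<close> is a proper nonempty subset that realises approximately every one-point
  extension type over its finite subsets.  Completeness makes these realisations exact, so by back
  and forth \<open>A\<close> is ultrahomogeneous.  Moreover, for some point \<open>x\<close> outside \<open>A\<close> and some \<open>k > 0\<close>,
  genericity provides over every finite \<open>S \<subseteq> A\<close> two points of \<open>A\<close> with the same distances to \<open>S\<close>,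
  whose distances to \<open>x\<close> differ by almost \<open>k\<close>.

  If \<open>f \<in> Iso(A, B)\<close> extends to an isometry of the whole space, the image of \<open>x\<close> is close to some \<open>y\<close>
  from a countable dense set, so \<open>|d(x, a) - d(y, f a)|\<close> is uniformly small on \<open>A\<close>.  For a fixed \<open>y\<close>
  such \<open>f\<close> form a nowhere dense set: composing \<open>f\<close> with an isometry of \<open>A\<close> that fixes \<open>S\<close> and
  carries one of the two points to the other violates the estimate without leaving a given neighbourhood
  of \<open>f\<close>.  As \<open>B\<close> was arbitrary, pairs with generic \<open>A\<close> and any closed \<open>B\<close> settle the second claim.
\<close>

section \<open>Meager sets\<close>

text \<open>The interior of the closure is itself an admissible \<open>W\<close>; if nonempty it
  contains a point of \<open>N\<close>, and the resulting \<open>V\<close> would contain a point of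
  the closure of \<open>N\<close> without meeting \<open>N\<close>.\<close>

lemma nowhere_dense_inI:
  assumes "N \<subseteq> topspace X"
    and "\<And>W a. openin X W \<Longrightarrow> a \<in> W \<Longrightarrow> a \<in> N \<Longrightarrow>
           \<exists>V. openin X V \<and> V \<inter> W \<noteq> {} \<and> V \<inter> N = {}"
  shows "nowhere_dense_in X N"
proof -
  let ?I = "X interior_of (X closure_of N)"
  have open_I: "openin X ?I" by simp
  have meets: "O' \<inter> N \<noteq> {}" if "openin X O'" "b \<in> O'" "b \<in> ?I" for O' b
  proof -
    have "b \<in> X closure_of N" using that(3) interior_of_subset by fast
    then show ?thesis using that(1,2) unfolding in_closure_of by blast
  qed
  have "?I = {}"
  proof (rule ccontr)
    assume "?I \<noteq> {}"
    then obtain a where "a \<in> ?I" "a \<in> N" using meets[OF open_I] by blast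
    then obtain V b where V: "openin X V" "b \<in> V" "b \<in> ?I" "V \<inter> N = {}"
      using assms(2)[OF open_I \<open>a \<in> ?I\<close> \<open>a \<in> N\<close>] by blast
    then show False using meets[OF V(1-3)] by blast
  qed
  then show ?thesis using assms(1) by (simp add: nowhere_dense_in_def)
qed

lemma nowhere_dense_in_subset:
  assumes "nowhere_dense_in X N" "M \<subseteq> N"
  shows "nowhere_dense_in X M"
proof -
  have "X interior_of (X closure_of M) \<subseteq> X interior_of (X closure_of N)"
    by (intro interior_of_mono closure_of_mono assms(2))
  then show ?thesis using assms unfolding nowhere_dense_in_def by blast
qed

lemma meager_inI:
  assumes "countable I" "\<And>i. i \<in> I \<Longrightarrow> nowhere_dense_in X (N i)" "S \<subseteq> (\<Union>i\<in>I. N i)"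
  shows "meager_in X S"
  unfolding meager_in_def
proof (intro exI conjI ballI)
  \<comment> \<open>\<open>meager_in\<close> demands equality with the union, so the covering sets
    are cut down to \<open>S\<close>.\<close>
  show "countable ((\<lambda>i. N i \<inter> S) ` I)" using assms(1) by blast
  show "nowhere_dense_in X M" if "M \<in> (\<lambda>i. N i \<inter> S) ` I" for M
    using that nowhere_dense_in_subset[OF assms(2)] by blast
  show "S = \<Union>((\<lambda>i. N i \<inter> S) ` I)" using assms(3) by blast
qed

text \<open>Closure and interior of a rectangle are taken factorwise, so a nowhere dense set stays
  nowhere dense when multiplied by the whole second factor.\<close>

lemma comeager_in_Times_topspace:
  assumes "comeager_in X G"
  shows "comeager_in (prod_topology X Y) (G \<times> topspace Y)"
proof -
  obtain \<N> where \<N>: "countable \<N>" "\<And>N. N \<in> \<N> \<Longrightarrow> nowhere_dense_in X N" "topspace X - G = \<Union>\<N>"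
    using assms by (auto simp: comeager_in_def meager_in_def)
  have "meager_in (prod_topology X Y) (topspace (prod_topology X Y) - G \<times> topspace Y)"
  proof (rule meager_inI[OF \<N>(1), where N = "\<lambda>N. N \<times> topspace Y"])
    show "nowhere_dense_in (prod_topology X Y) (N \<times> topspace Y)" if "N \<in> \<N>" for N
      using \<N>(2)[OF that] by (auto simp: nowhere_dense_in_def closure_of_Times interior_of_Times)
    show "topspace (prod_topology X Y) - G \<times> topspace Y \<subseteq> (\<Union>N\<in>\<N>. N \<times> topspace Y)"
      using \<N>(3) by auto
  qed
  then show ?thesis using assms by (auto simp: comeager_in_def)
qed


section \<open>One-point extensions in the Urysohn space\<close>

text \<open>\<open>universal_Polish\<close> only concerns metrics on sets of reals, so the finite
  metric is transported along an injection into the naturals. Finite spaces are compact, hence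
  complete.\<close>

lemma universal_Polish_finite:
  fixes d :: "'b \<Rightarrow> 'b \<Rightarrow> real"
  assumes "universal_Polish TYPE('a::metric_space)" and "finite M" and "Metric_space M d"
  obtains e :: "'b \<Rightarrow> 'a::metric_space" where "\<And>x y. x \<in> M \<Longrightarrow> y \<in> M \<Longrightarrow> dist (e x) (e y) = d x y"
proof -
  obtain f :: "'b \<Rightarrow> nat" where f: "inj_on f M"
    using finite_imp_inj_to_nat_seg[OF assms(2)] by blast
  define g where "g = (\<lambda>x. real (f x))"
  have g: "inj_on g M" using f by (auto simp: g_def inj_on_def)
  define h where "h = inv_into M g"
  have hg: "h (g x) = x" if "x \<in> M" for x using that g by (simp add: h_def)
  interpret M: Metric_space M d by fact
  interpret R: Metric_space "g ` M" "\<lambda>x y. d (h x) (h y)"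
  proof
    show "0 \<le> d (h x) (h y)" for x y by simp
    show "d (h x) (h y) = d (h y) (h x)" for x y by (rule M.commute)
  next
    fix x y assume "x \<in> g ` M" "y \<in> g ` M"
    then show "d (h x) (h y) = 0 \<longleftrightarrow> x = y" using hg by auto
  next
    fix x y z assume "x \<in> g ` M" "y \<in> g ` M" "z \<in> g ` M"
    then show "d (h x) (h z) \<le> d (h x) (h y) + d (h y) (h z)"
      using hg M.triangle by auto
  qed
  define m where "m = metric (g ` M, \<lambda>x y. d (h x) (h y))"
  have "mcomplete_of m"
    using assms(2) by (auto simp: m_def compact_space_def finite_imp_compactin intro!: R.compact_space_imp_mcomplete)
  moreover have "separable_space (mtopology_of m)"
    unfolding separable_space_def m_def using assms(2)
    using closure_of_topspace[of R.mtopology] by (intro exI[of _ "g ` M"]) (simp add: countable_finite)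
  ultimately obtain e :: "real \<Rightarrow> 'a"
    where e: "\<forall>x\<in>mspace m. \<forall>y\<in>mspace m. dist (e x) (e y) = mdist m x y"
    using assms(1) unfolding universal_Polish_def by blast
  show thesis
    by (rule that[of "e \<circ> g"]) (use e hg in \<open>simp add: m_def\<close>)
qed

text \<open>The hypotheses say that \<open>p\<close> is a Katetov function: it describes a metric on
  \<open>S\<close> with one extra point. Universality embeds this finite space, and ultrahomogeneity
  moves the copy of \<open>S\<close> back onto \<open>S\<close>.\<close>

lemma Urysohn_one_point_extension:
  fixes S :: "'a::polish_space set"
  assumes U: "Urysohn_space TYPE('a)" and "finite S"
    and lip: "\<And>s t. s \<in> S \<Longrightarrow> t \<in> S \<Longrightarrow> \<bar>p s - p t\<bar> \<le> dist s t"
    and sum: "\<And>s t. s \<in> S \<Longrightarrow> t \<in> S \<Longrightarrow> dist s t \<le> p s + p t"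
  obtains u where "\<And>s. s \<in> S \<Longrightarrow> dist u s = p s"
proof (cases "\<exists>s\<in>S. p s = 0")
  case True
  then obtain s where s: "s \<in> S" "p s = 0" by blast
  \<comment> \<open>A zero of \<open>p\<close> at \<open>s\<close> forces the new point to be
    \<open>s\<close>; a separate extra point would violate the metric axioms.\<close>
  show ?thesis
  proof (rule that)
    fix t assume "t \<in> S"
    with lip[OF s(1) this] sum[OF s(1) this] s(2) show "dist s t = p t" by simp
  qed
next
  case False
  have pos: "0 < p s" if "s \<in> S" for s
    using sum[OF that that] False that by (simp add: order_less_le)
  \<comment> \<open>\<open>Metric_space\<close> asks for nonnegativity on the whole type; the
    absolute values secure it and change nothing on \<open>S\<close>, where \<open>p\<close> is
    positive.\<close>
  define d :: "'a option \<Rightarrow> 'a option \<Rightarrow> real" where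
    "d = (\<lambda>x y. case x of None \<Rightarrow> (case y of None \<Rightarrow> 0 | Some t \<Rightarrow> \<bar>p t\<bar>)
                 | Some s \<Rightarrow> (case y of None \<Rightarrow> \<bar>p s\<bar> | Some t \<Rightarrow> dist s t))"
  have abs_lip: "\<bar>p s\<bar> \<le> dist s t + \<bar>p t\<bar>" and abs_lip': "\<bar>p t\<bar> \<le> \<bar>p s\<bar> + dist s t"
    and abs_sum: "dist s t \<le> \<bar>p s\<bar> + \<bar>p t\<bar>" if "s \<in> S" "t \<in> S" for s t
    using lip[OF that] sum[OF that] by linarith+
  let ?M = "insert None (Some ` S)"
  have met: "Metric_space ?M d"
  proof
    show "0 \<le> d x y" for x y by (auto simp: d_def split: option.split)
    show "d x y = d y x" for x y by (auto simp: d_def dist_commute split: option.split)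
  next
    fix x y assume "x \<in> ?M" "y \<in> ?M"
    then show "d x y = 0 \<longleftrightarrow> x = y" using False by (auto simp: d_def)
  next
    fix x y z assume "x \<in> ?M" "y \<in> ?M" "z \<in> ?M"
    then show "d x z \<le> d x y + d y z"
      using abs_lip abs_lip' abs_sum by (auto simp: d_def dist_triangle)
  qed
  have univ: "universal_Polish TYPE('a)" and fin: "finite ?M"
    using U \<open>finite S\<close> by (auto simp: Urysohn_space_def)
  obtain e :: "'a option \<Rightarrow> 'a"
    where e: "\<And>x y. x \<in> ?M \<Longrightarrow> y \<in> ?M \<Longrightarrow> dist (e x) (e y) = d x y"
    by (rule universal_Polish_finite[OF univ fin met]) (rule that)
  have es: "dist (e (Some s)) (e (Some t)) = dist s t" if "s \<in> S" "t \<in> S" for s t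
    using e that by (simp add: d_def)
  have inj: "inj_on (e \<circ> Some) S" by (rule inj_onI) (metis comp_apply dist_eq_0_iff es)
  let ?T = "(e \<circ> Some) ` S"
  define \<phi> where "\<phi> = restrict (inv_into S (e \<circ> Some)) ?T"
  have \<phi>: "\<phi> (e (Some s)) = s" if "s \<in> S" for s
    using inv_into_f_f[OF inj that] that by (simp add: \<phi>_def)
  have "\<phi> \<in> Iso ?T S"
    unfolding Iso_def
  proof (intro CollectI conjI ballI)
    show "\<phi> \<in> extensional ?T" by (simp add: \<phi>_def)
    show "bij_betw \<phi> ?T S"
      unfolding \<phi>_def bij_betw_restrict_eq
      by (rule bij_betw_inv_into[OF inj_on_imp_bij_betw[OF inj]])
  next
    fix x y assume "x \<in> ?T" "y \<in> ?T"
    then show "dist (\<phi> x) (\<phi> y) = dist x y" by (auto simp: \<phi> es)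
  qed
  then have "extends_to_isometry ?T \<phi>"
    using U \<open>finite S\<close> unfolding Urysohn_space_def ultrahomogeneous_def by blast
  then obtain g where g: "g \<in> Iso UNIV UNIV" "\<And>s. s \<in> S \<Longrightarrow> g (e (Some s)) = s"
    by (auto simp: extends_to_isometry_def \<phi>)
  show ?thesis
  proof (rule that)
    fix s assume "s \<in> S"
    then have "dist (g (e None)) s = dist (g (e None)) (g (e (Some s)))" by (simp add: g(2))
    also have "\<dots> = dist (e None) (e (Some s))" using g(1) by (simp add: Iso_def)
    also have "\<dots> = p s" using e[of None "Some s"] pos[OF \<open>s \<in> S\<close>] \<open>s \<in> S\<close> by (simp add: d_def)
    finally show "dist (g (e None)) s = p s" .
  qed
qed

text \<open>The metric amalgam of \<open>S \<union> {u}\<close> and \<open>S \<union> X\<close> over \<open>S\<close>: the copy of \<open>u\<close> is as far away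
  from \<open>X\<close> as the distances to \<open>S\<close> permit.\<close>

lemma Urysohn_amalgam:
  fixes S X :: "'a::polish_space set"
  assumes U: "Urysohn_space TYPE('a)" and "finite S" "S \<noteq> {}" "finite X"
  obtains z where "\<And>s. s \<in> S \<Longrightarrow> dist z s = dist u s"
    and "\<And>x. x \<in> X \<Longrightarrow> \<exists>s\<in>S. dist z x = dist u s + dist s x"
proof -
  define p where "p = (\<lambda>y. Min ((\<lambda>s. dist u s + dist s y) ` S))"
  have le: "p y \<le> dist u s + dist s y" if "s \<in> S" for s y
    using that assms by (simp add: p_def)
  have ex: "\<exists>s\<in>S. p y = dist u s + dist s y" for y
    using Min_in[of "(\<lambda>s. dist u s + dist s y) ` S"] assms(2,3) unfolding p_def by fastforce
  have lip: "p y \<le> p y' + dist y y'" for y y'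
  proof -
    obtain s where "s \<in> S" "p y' = dist u s + dist s y'" using ex by blast
    with le[of s y] dist_triangle[of s y y'] show ?thesis by (simp add: dist_commute)
  qed
  \<comment> \<open>\<open>p\<close> dominates the distance to \<open>u\<close>, so the triangle
    inequality through \<open>u\<close> suffices.\<close>
  have sum: "dist y y' \<le> p y + p y'" for y y'
  proof -
    obtain s s' where "p y = dist u s + dist s y" "p y' = dist u s' + dist s' y'" using ex by meson
    moreover have "dist u y \<le> dist u s + dist s y" "dist u y' \<le> dist u s' + dist s' y'"
      by (rule dist_triangle)+
    moreover have "dist y y' \<le> dist u y + dist u y'" by (metis dist_commute dist_triangle)
    ultimately show ?thesis by linarith
  qed
  have "\<bar>p s - p t\<bar> \<le> dist s t" for s t
    using lip[of s t] lip[of t s] by (simp add: dist_commute abs_le_iff)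
  then obtain z where z: "\<And>s. s \<in> S \<union> X \<Longrightarrow> dist z s = p s"
    using Urysohn_one_point_extension[OF U, of "S \<union> X" p] assms sum by blast
  have "p s = dist u s" if "s \<in> S" for s
  proof (rule antisym)
    show "p s \<le> dist u s" using le[OF that, of s] by simp
    show "dist u s \<le> p s" using ex[of s] by (metis dist_triangle)
  qed
  then show ?thesis using that z ex by (metis UnCI)
qed

text \<open>A constant is a Katetov function as soon as its double bounds all distances in
  \<open>X\<close>.\<close>

lemma Urysohn_far_point:
  fixes X :: "'a::polish_space set"
  assumes U: "Urysohn_space TYPE('a)" and "finite X"
  obtains z R where "r < R" "\<And>x. x \<in> X \<Longrightarrow> dist z x = R"
proof -
  define R where "R = max (r + 1) (diameter X)"
  have "dist s t \<le> R + R" if "s \<in> X" "t \<in> X" for s t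
    using diameter_bounded_bound[OF finite_imp_bounded[OF \<open>finite X\<close>] that]
      zero_le_dist[of s t] unfolding R_def by linarith
  then obtain z where "\<And>x. x \<in> X \<Longrightarrow> dist z x = R"
    using Urysohn_one_point_extension[OF U \<open>finite X\<close>, of "\<lambda>_. R"] by auto
  moreover have "r < R" by (simp add: R_def)
  ultimately show ?thesis using that by blast
qed

section \<open>Wijsman neighbourhoods\<close>

lemma dist_to_set_empty [simp]: "dist_to_set x {} = \<infinity>"
  by (simp add: dist_to_set_def top_ereal_def)

lemma dist_to_set_singleton [simp]: "dist_to_set x {z} = ereal (dist x z)"
  by (simp add: dist_to_set_def)

lemma dist_to_set_less_iff: "dist_to_set x F < ereal e \<longleftrightarrow> (\<exists>y\<in>F. dist x y < e)"
  by (simp add: dist_to_set_def INF_less_iff)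

lemma dist_to_set_Un_eq:
  assumes "\<And>z. z \<in> Z \<Longrightarrow> \<exists>a\<in>A. dist x a \<le> dist x z"
  shows "dist_to_set x (A \<union> Z) = dist_to_set x A"
proof -
  have "dist_to_set x A \<le> dist_to_set x Z"
    unfolding dist_to_set_def using assms by (intro INF_mono) auto
  then show ?thesis by (simp add: dist_to_set_def INF_union inf_absorb1)
qed

lemma openin_Wijsman_dist: "open V \<Longrightarrow> openin Wijsman {F. closed F \<and> dist_to_set x F \<in> V}"
  unfolding Wijsman_def by (rule topology_generated_by_Basis) blast

lemma openin_Wijsman_dist_less: "openin Wijsman {F. closed F \<and> dist_to_set x F < e}"
  using openin_Wijsman_dist[of "{..<e}" x] by simp

lemma openin_Wijsman_dist_greater: "openin Wijsman {F. closed F \<and> e < dist_to_set x F}"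
  using openin_Wijsman_dist[of "{e<..}" x] by simp

text \<open>Each subbasic set restricts one distance, so finitely many distances guarantee
  membership. At \<open>A = {}\<close> they are all infinite, and neighbourhoods of infinity contain
  rays; hence the alternative with \<open>R\<close>.\<close>

lemma Wijsman_neighbourhood:
  assumes "openin Wijsman W" "A \<in> W"
  obtains X R where "finite X"
    and "\<forall>F. closed F \<longrightarrow> (\<forall>x\<in>X. dist_to_set x F = dist_to_set x A \<or>
           A = {} \<and> ereal R < dist_to_set x F) \<longrightarrow> F \<in> W"
proof -
  have "\<exists>X R. finite X \<and> (\<forall>F. closed F \<longrightarrow> (\<forall>x\<in>X. dist_to_set x F = dist_to_set x A \<or>
           A = {} \<and> ereal R < dist_to_set x F) \<longrightarrow> F \<in> W)"
    using openin_topology_generated_by[OF assms(1)[unfolded Wijsman_def]] assms(2)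
  proof (induction rule: generate_topology_on.induct)
    case Empty
    then show ?case by simp
  next
    case (Int U V)
    obtain X R where X: "finite X" "\<forall>F. closed F \<longrightarrow> (\<forall>x\<in>X. dist_to_set x F = dist_to_set x A \<or>
           A = {} \<and> ereal R < dist_to_set x F) \<longrightarrow> F \<in> U"
      using Int.IH(1) Int.prems by auto
    obtain Y R' where Y: "finite Y" "\<forall>F. closed F \<longrightarrow> (\<forall>x\<in>Y. dist_to_set x F = dist_to_set x A \<or>
           A = {} \<and> ereal R' < dist_to_set x F) \<longrightarrow> F \<in> V"
      using Int.IH(2) Int.prems by auto
    have max: "ereal R < t" "ereal R' < t" if "ereal (max R R') < t" for t
      using that by (auto elim: le_less_trans[rotated])
    show ?case
    proof (intro exI[of _ "X \<union> Y"] exI[of _ "max R R'"] conjI allI impI)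
      show "finite (X \<union> Y)" using X(1) Y(1) by simp
    next
      fix F assume "closed F" and F: "\<forall>x\<in>X \<union> Y. dist_to_set x F = dist_to_set x A \<or>
           A = {} \<and> ereal (max R R') < dist_to_set x F"
      have "F \<in> U" using F max(1) by (intro X(2)[rule_format, OF \<open>closed F\<close>]) blast
      moreover have "F \<in> V" using F max(2) by (intro Y(2)[rule_format, OF \<open>closed F\<close>]) blast
      ultimately show "F \<in> U \<inter> V" by blast
    qed
  next
    case (UN K)
    then obtain U where "U \<in> K" "A \<in> U" by blast
    with UN.IH[OF this] show ?case by blast
  next
    case (Basis s)
    then obtain x V where s: "s = {F. closed F \<and> dist_to_set x F \<in> V}" "open V" by blast
    show ?case
    proof (cases "A = {}")
      case True
      then obtain R where "{ereal R<..} \<subseteq> V" using Basis s open_PInfty[of V] by auto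
      with s Basis show ?thesis by (intro exI[of _ "{x}"] exI[of _ R]) auto
    next
      case False
      with s Basis show ?thesis by (intro exI[of _ "{x}"]) auto
    qed
  qed
  then show ?thesis using that by blast
qed

text \<open>Added points that are no closer to \<open>x\<close> than \<open>A\<close> leave the
  distance from \<open>x\<close> unchanged. This is how \<open>A\<close> is perturbed inside
  \<open>W\<close> in the density arguments.\<close>

lemma Wijsman_add_finite:
  assumes W: "openin Wijsman W" "A \<in> W"
  obtains X where "finite X"
    and "\<forall>Z. finite Z \<longrightarrow> (\<forall>x\<in>X. \<forall>z\<in>Z. \<exists>a\<in>A. dist x a \<le> dist x z) \<longrightarrow> A \<union> Z \<in> W"
proof -
  obtain X R where X: "finite X" "\<forall>F. closed F \<longrightarrow> (\<forall>x\<in>X. dist_to_set x F = dist_to_set x A \<or>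
           A = {} \<and> ereal R < dist_to_set x F) \<longrightarrow> F \<in> W"
    by (rule Wijsman_neighbourhood[OF W]) (rule that)
  have "closed A" using openin_subset[OF W(1)] W(2) by auto
  show thesis
  proof (rule that[OF X(1)], intro allI impI)
    fix Z assume "finite Z" "\<forall>x\<in>X. \<forall>z\<in>Z. \<exists>a\<in>A. dist x a \<le> dist x z"
    then show "A \<union> Z \<in> W"
      using \<open>closed A\<close> by (intro X(2)[rule_format] disjI1 dist_to_set_Un_eq) (auto simp: finite_imp_closed)
  qed
qed


section \<open>Generic closed sets\<close>

text \<open>A singleton far from the finitely many relevant points lies in \<open>W\<close>, and
  coming within 1 of \<open>z\<close> is an open condition that \<open>{}\<close> violates.\<close>

lemma nowhere_dense_singleton_empty:
  assumes U: "Urysohn_space TYPE('a::polish_space)"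
  shows "nowhere_dense_in Wijsman {{} :: 'a set}"
proof (rule nowhere_dense_inI)
  fix W and A :: "'a set" assume W: "openin Wijsman W" "A \<in> W" "A \<in> {{}}"
  obtain X R where X: "finite X" "\<forall>F. closed F \<longrightarrow> (\<forall>x\<in>X. dist_to_set x F = dist_to_set x A \<or>
           A = {} \<and> ereal R < dist_to_set x F) \<longrightarrow> F \<in> W"
    by (rule Wijsman_neighbourhood[OF W(1,2)]) (rule that)
  obtain z R' where z: "R < R'" "\<And>x. x \<in> X \<Longrightarrow> dist z x = R'"
    by (rule Urysohn_far_point[OF U X(1)]) (rule that)
  have "{z} \<in> W" using W(3) z by (intro X(2)[rule_format]) (auto simp: dist_commute)
  then show "\<exists>V. openin Wijsman V \<and> V \<inter> W \<noteq> {} \<and> V \<inter> {{}} = {}"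
    using openin_Wijsman_dist_less[of z 1] zero_less_one
    by (intro exI[of _ "{F. closed F \<and> dist_to_set z F < 1}"]) (force dest: equals0D[of _ "{z}"])
qed simp

text \<open>The finite set \<open>X\<close> has the same relevant distances as \<open>UNIV\<close>,
  all zero; a point off \<open>X\<close> then separates the two by an open condition.\<close>

lemma nowhere_dense_singleton_UNIV:
  assumes U: "Urysohn_space TYPE('a::polish_space)"
  shows "nowhere_dense_in Wijsman {UNIV :: 'a set}"
proof (rule nowhere_dense_inI)
  fix W and A :: "'a set" assume W: "openin Wijsman W" "A \<in> W" "A \<in> {UNIV}"
  obtain X R where X: "finite X" "\<forall>F. closed F \<longrightarrow> (\<forall>x\<in>X. dist_to_set x F = dist_to_set x A \<or>
           A = {} \<and> ereal R < dist_to_set x F) \<longrightarrow> F \<in> W"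
    by (rule Wijsman_neighbourhood[OF W(1,2)]) (rule that)
  have zero: "dist_to_set x F = 0" if "x \<in> F" for x :: 'a and F
    using that dist_to_set_eq_infdist[of F x] by (auto simp: zero_ereal_def)
  have "X \<in> W" using W(3) X(1) by (intro X(2)[rule_format]) (auto simp: finite_imp_closed zero)
  obtain z and R' :: real where "0 < R'" "\<And>x. x \<in> X \<Longrightarrow> dist z x = R'"
    by (rule Urysohn_far_point[OF U X(1)]) (rule that)
  then have "z \<notin> X" by fastforce
  then have "0 < dist_to_set z X"
    using infdist_pos_not_in_closed[OF finite_imp_closed[OF X(1)]]
    by (cases "X = {}") (auto simp: dist_to_set_eq_infdist)
  then show "\<exists>V. openin Wijsman V \<and> V \<inter> W \<noteq> {} \<and> V \<inter> {UNIV} = {}"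
    using \<open>X \<in> W\<close> openin_Wijsman_dist_greater[of 0 z] X(1)
    by (intro exI[of _ "{F. closed F \<and> 0 < dist_to_set z F}"])
      (force simp: zero finite_imp_closed dest: equals0D[of _ X])
qed simp

text \<open>\<open>C\<close> need not lie in \<open>A\<close>, so it can later range over a
  countable family. Each \<open>c\<close> is replaced by a nearby point of \<open>A\<close>, and a
  point \<open>z\<close> with exactly the distances of \<open>u\<close> to the replacements is added
  to \<open>A\<close>.\<close>

lemma nowhere_dense_type_omitted:
  fixes C :: "'a::polish_space set"
  assumes U: "Urysohn_space TYPE('a)" and "finite C" "C \<noteq> {}" "0 < e"
  shows "nowhere_dense_in Wijsman {A. closed A \<and> (\<forall>c\<in>C. \<exists>a\<in>A. dist c a < e) \<and>
           \<not> (\<exists>w\<in>A. \<forall>c\<in>C. \<bar>dist w c - dist u c\<bar> < 3 * e)}" (is "nowhere_dense_in _ ?N")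
proof (rule nowhere_dense_inI)
  fix W A assume W: "openin Wijsman W" "A \<in> W" "A \<in> ?N"
  then have "\<forall>c\<in>C. \<exists>a. a \<in> A \<and> dist c a < e" by blast
  then obtain a where a: "\<And>c. c \<in> C \<Longrightarrow> a c \<in> A" "\<And>c. c \<in> C \<Longrightarrow> dist c (a c) < e"
    using bchoice[of C "\<lambda>c a. a \<in> A \<and> dist c a < e"] by blast
  obtain X where X: "finite X"
    "\<forall>Z. finite Z \<longrightarrow> (\<forall>x\<in>X. \<forall>z\<in>Z. \<exists>a\<in>A. dist x a \<le> dist x z) \<longrightarrow> A \<union> Z \<in> W"
    by (rule Wijsman_add_finite[OF W(1,2)]) (rule that)
  have fin: "finite (a ` C)" "a ` C \<noteq> {}" using assms by auto
  obtain z where z: "\<And>s. s \<in> a ` C \<Longrightarrow> dist z s = dist u s"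
    "\<And>x. x \<in> X \<Longrightarrow> \<exists>s\<in>a ` C. dist z x = dist u s + dist s x"
    by (rule Urysohn_amalgam[OF U fin X(1)]) (rule that)
  have "A \<union> {z} \<in> W"
  proof (rule X(2)[rule_format])
    fix x z' assume "x \<in> X" "z' \<in> {z}"
    \<comment> \<open>The amalgam reaches \<open>x\<close> only through some \<open>s\<close> in
      \<open>A\<close>, so \<open>s\<close> is at least as close to \<open>x\<close>.\<close>
    then show "\<exists>a\<in>A. dist x a \<le> dist x z'"
      using z(2)[of x] a(1) by (force simp: dist_commute)
  qed simp
  let ?V = "{F. closed F \<and> dist_to_set z F < ereal e}"
  have "A \<union> {z} \<in> ?V"
    using W(3) \<open>0 < e\<close> unfolding dist_to_set_less_iff by auto
  moreover have "?V \<inter> ?N = {}"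
  proof -
    have False if "F \<in> ?V" "F \<in> ?N" for F
    proof -
      obtain w where w: "w \<in> F" "dist z w < e" using \<open>F \<in> ?V\<close> by (auto simp: dist_to_set_less_iff)
      \<comment> \<open>Three errors below \<open>e\<close>: \<open>z\<close> against
        \<open>w\<close>, and \<open>c\<close> against \<open>a c\<close>, once for \<open>z\<close>
        and once for \<open>u\<close>.\<close>
      have "\<bar>dist w c - dist u c\<bar> < 3 * e" if "c \<in> C" for c
        using w(2) a(2)[OF that] z(1)[of "a c"] that
          abs_dist_diff_le[of w c z] abs_dist_diff_le[of c z "a c"] abs_dist_diff_le[of c u "a c"]
        by (simp add: dist_commute abs_le_iff abs_less_iff)
      then show False using w(1) \<open>F \<in> ?N\<close> by auto
    qed
    then show ?thesis by blast
  qed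
  ultimately show "\<exists>V. openin Wijsman V \<and> V \<inter> W \<noteq> {} \<and> V \<inter> ?N = {}"
    using \<open>A \<union> {z} \<in> W\<close> openin_Wijsman_dist_less[of z "ereal e"] by (intro exI[of _ ?V]) blast
qed auto

text \<open>Two points with the same distance \<open>R\<close> to the replacements of
  \<open>C\<close> are added to \<open>A\<close>: \<open>z\<close> has distance \<open>R\<close> to
  \<open>x\<close> too, while \<open>z'\<close> is amalgamated with \<open>x\<close> through the
  replacements, so its distance to \<open>x\<close> is at least \<open>R + k\<close>.\<close>

lemma nowhere_dense_type_determines_dist:
  fixes C :: "'a::polish_space set"
  assumes U: "Urysohn_space TYPE('a)" and "finite C" "C \<noteq> {}" "0 < e"
  shows "nowhere_dense_in Wijsman {A. closed A \<and> (\<forall>c\<in>C. \<exists>a\<in>A. dist c a < e) \<and> (\<forall>a\<in>A. k \<le> dist x a) \<and>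
           \<not> (\<exists>w\<in>A. \<exists>w'\<in>A. (\<forall>c\<in>C. \<bar>dist w c - dist w' c\<bar> < 4 * e) \<and> k - 2 * e \<le> dist w' x - dist w x)}"
    (is "nowhere_dense_in _ ?N")
proof (rule nowhere_dense_inI)
  fix W A assume W: "openin Wijsman W" "A \<in> W" "A \<in> ?N"
  then have "\<forall>c\<in>C. \<exists>a. a \<in> A \<and> dist c a < e" by blast
  then obtain a where a: "\<And>c. c \<in> C \<Longrightarrow> a c \<in> A" "\<And>c. c \<in> C \<Longrightarrow> dist c (a c) < e"
    using bchoice[of C "\<lambda>c a. a \<in> A \<and> dist c a < e"] by blast
  obtain X where X: "finite X"
    "\<forall>Z. finite Z \<longrightarrow> (\<forall>x\<in>X. \<forall>z\<in>Z. \<exists>a\<in>A. dist x a \<le> dist x z) \<longrightarrow> A \<union> Z \<in> W"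
    by (rule Wijsman_add_finite[OF W(1,2)]) (rule that)
  obtain c0 where "c0 \<in> C" using \<open>C \<noteq> {}\<close> by blast
  \<comment> \<open>Points farther than \<open>r\<close> from \<open>X\<close> are farther than
    \<open>a c0\<close> from each point of \<open>X\<close>, so \<open>z\<close> may be added to
    \<open>A\<close>.\<close>
  define r where "r = (\<Sum>y\<in>X. dist y (a c0))"
  have r: "dist y (a c0) \<le> r" if "y \<in> X" for y
    unfolding r_def using X(1) that by (intro member_le_sum) auto
  have fin: "finite (a ` C)" "a ` C \<noteq> {}" "finite (insert x X)" "finite (insert x (X \<union> a ` C))"
    using assms X(1) by auto
  obtain z R where z: "r < R" "\<And>y. y \<in> insert x (X \<union> a ` C) \<Longrightarrow> dist z y = R"
    by (rule Urysohn_far_point[OF U fin(4)]) (rule that)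
  obtain z' where z': "\<And>s. s \<in> a ` C \<Longrightarrow> dist z' s = dist z s"
    "\<And>y. y \<in> insert x X \<Longrightarrow> \<exists>s\<in>a ` C. dist z' y = dist z s + dist s y"
    by (rule Urysohn_amalgam[OF U fin(1-3)]) (rule that)
  have "A \<union> {z, z'} \<in> W"
  proof (rule X(2)[rule_format])
    fix y v assume "y \<in> X" "v \<in> {z, z'}"
    then consider "v = z" | "v = z'" by blast
    then show "\<exists>a\<in>A. dist y a \<le> dist y v"
    proof cases
      case 1
      then show ?thesis
        using r[OF \<open>y \<in> X\<close>] z(1) z(2)[of y] \<open>y \<in> X\<close> a(1)[OF \<open>c0 \<in> C\<close>]
        by (intro bexI[of _ "a c0"]) (auto simp: dist_commute)
    next
      case 2
      then show ?thesis
        using z'(2)[of y] \<open>y \<in> X\<close> a(1) by (force simp: dist_commute)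
    qed
  qed simp
  have gap: "R + k \<le> dist z' x"
  proof -
    obtain c where "c \<in> C" "dist z' x = dist z (a c) + dist (a c) x" using z'(2)[of x] by auto
    moreover have "k \<le> dist x (a c)" using W(3) a(1)[OF \<open>c \<in> C\<close>] by blast
    ultimately show ?thesis using z(2)[of "a c"] by (simp add: dist_commute)
  qed
  let ?V = "{F. closed F \<and> dist_to_set z F < ereal e} \<inter> {F. closed F \<and> dist_to_set z' F < ereal e}"
  have "A \<union> {z, z'} \<in> ?V"
    using W(3) \<open>0 < e\<close> unfolding dist_to_set_less_iff by auto
  moreover have "?V \<inter> ?N = {}"
  proof -
    have False if "F \<in> ?V" "F \<in> ?N" for F
    proof -
      obtain w w' where w: "w \<in> F" "dist z w < e" "w' \<in> F" "dist z' w' < e"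
        using \<open>F \<in> ?V\<close> by (auto simp: dist_to_set_less_iff)
      have "\<bar>dist w c - dist w' c\<bar> < 4 * e" if "c \<in> C" for c
        using w(2,4) a(2)[OF that] z'(1)[of "a c"] that
          abs_dist_diff_le[of w c z] abs_dist_diff_le[of w' c z']
          abs_dist_diff_le[of c z "a c"] abs_dist_diff_le[of c z' "a c"]
        by (simp add: dist_commute abs_le_iff abs_less_iff)
      moreover have "k - 2 * e \<le> dist w' x - dist w x"
        using w(2,4) gap z(2)[of x] abs_dist_diff_le[of w x z] abs_dist_diff_le[of w' x z']
        by (simp add: dist_commute abs_le_iff)
      ultimately show False using w(1,3) \<open>F \<in> ?N\<close> by blast
    qed
    then show ?thesis by blast
  qed
  moreover have "openin Wijsman ?V"
    by (intro openin_Int openin_Wijsman_dist_less)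
  ultimately show "\<exists>V. openin Wijsman V \<and> V \<inter> W \<noteq> {} \<and> V \<inter> ?N = {}"
    using \<open>A \<union> {z, z'} \<in> W\<close> by (intro exI[of _ ?V]) blast
qed auto

section \<open>One-point types over finite subsets of a generic set\<close>

text \<open>In the Urysohn space every Katetov function on a finite set is the distance function of
  some \<open>u\<close>, so \<open>u\<close> ranges over all one-point extension types.\<close>

definition approximately_injective :: "'a::metric_space set \<Rightarrow> bool" where
  "approximately_injective A \<longleftrightarrow> (\<forall>S u e. finite S \<and> S \<noteq> {} \<and> S \<subseteq> A \<and> 0 < e \<longrightarrow>
     (\<exists>w\<in>A. \<forall>s\<in>S. \<bar>dist w s - dist u s\<bar> < e))"

definition finitely_injective :: "'a::metric_space set \<Rightarrow> bool" where
  "finitely_injective A \<longleftrightarrow> (\<forall>S u. finite S \<and> S \<subseteq> A \<longrightarrow> (\<exists>w\<in>A. \<forall>s\<in>S. dist w s = dist u s))"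

text \<open>\<open>k\<close> is fixed before \<open>S\<close> and \<open>e\<close>; this uniform gap
  later works in every neighbourhood of an isometry.\<close>

definition dist_undetermined :: "'a::metric_space set \<Rightarrow> 'a \<Rightarrow> real \<Rightarrow> bool" where
  "dist_undetermined A x k \<longleftrightarrow> (\<forall>S e. finite S \<and> S \<noteq> {} \<and> S \<subseteq> A \<and> 0 < e \<longrightarrow>
     (\<exists>w\<in>A. \<exists>w'\<in>A. (\<forall>s\<in>S. \<bar>dist w s - dist w' s\<bar> < e) \<and> k - e \<le> dist w' x - dist w x))"

lemma dense_approx:
  fixes D :: "'a::metric_space set"
  assumes "\<And>X. open X \<Longrightarrow> X \<noteq> {} \<Longrightarrow> \<exists>d\<in>D. d \<in> X" "0 < e"
  obtains d where "d \<in> D" "dist x d < e"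
  using assms(1)[of "ball x e"] assms(2) by auto

text \<open>Parameters come from a countable dense set and tolerances from \<open>r\<close>, which
  leaves countably many exceptional sets. A dense subset of \<open>A\<close> would not serve, as it
  varies with \<open>A\<close>.\<close>

lemma comeager_generic:
  assumes U: "Urysohn_space TYPE('a::polish_space)"
  shows "comeager_in Wijsman {A :: 'a set. closed A \<and> A \<noteq> {} \<and> approximately_injective A \<and>
           (\<exists>x k. 0 < k \<and> dist_undetermined A x k)}" (is "comeager_in _ ?G")
proof -
  obtain D :: "'a set" where D: "countable D" "\<And>X. open X \<Longrightarrow> X \<noteq> {} \<Longrightarrow> \<exists>d\<in>D. d \<in> X"
    by (rule countable_dense_setE) blast
  define \<C> where "\<C> = {C. finite C \<and> C \<subseteq> D} - {{}}"
  have "countable \<C>" unfolding \<C>_def using countable_Collect_finite_subset[OF D(1)] by blast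
  define r where "r = (\<lambda>n. inverse (real (Suc n)))"
  have r: "0 < r n" for n by (simp add: r_def)
  have small: "\<exists>n. r n < e" if "0 < e" for e
    using reals_Archimedean[OF that] by (auto simp: r_def)
  define N1 where "N1 = (\<lambda>(C, u, n). {A :: 'a set. closed A \<and> (\<forall>c\<in>C. \<exists>a\<in>A. dist c a < r n) \<and>
           \<not> (\<exists>w\<in>A. \<forall>c\<in>C. \<bar>dist w c - dist u c\<bar> < 3 * r n)})"
  define N2 where "N2 = (\<lambda>(C, x, m, n). {A :: 'a set. closed A \<and> (\<forall>c\<in>C. \<exists>a\<in>A. dist c a < r n) \<and>
           (\<forall>a\<in>A. r m \<le> dist x a) \<and>
           \<not> (\<exists>w\<in>A. \<exists>w'\<in>A. (\<forall>c\<in>C. \<bar>dist w c - dist w' c\<bar> < 4 * r n) \<and> r m - 2 * r n \<le> dist w' x - dist w x)})"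
  define \<N> where "\<N> = {{{}}, {UNIV}} \<union> N1 ` (\<C> \<times> D \<times> UNIV) \<union> N2 ` (\<C> \<times> D \<times> UNIV \<times> UNIV)"
  have "countable \<N>" unfolding \<N>_def using \<open>countable \<C>\<close> D(1)
    by (intro countable_Un countable_image countable_SIGMA) auto
  have N1: "nowhere_dense_in Wijsman (N1 (C, u, n))" if "C \<in> \<C>" for C u n
    unfolding N1_def prod.case by (rule nowhere_dense_type_omitted[OF U]) (use that r in \<open>auto simp: \<C>_def\<close>)
  have N2: "nowhere_dense_in Wijsman (N2 (C, x, m, n))" if "C \<in> \<C>" for C x m n
    unfolding N2_def prod.case by (rule nowhere_dense_type_determines_dist[OF U]) (use that r in \<open>auto simp: \<C>_def\<close>)
  have nd: "nowhere_dense_in Wijsman N" if "N \<in> \<N>" for N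
    using that N1 N2 nowhere_dense_singleton_empty[OF U] nowhere_dense_singleton_UNIV[OF U]
    unfolding \<N>_def by blast
  have "topspace Wijsman - ?G \<subseteq> \<Union>\<N>"
  proof
    fix A :: "'a set" assume A: "A \<in> topspace Wijsman - ?G"
    then have "closed A" by simp
    show "A \<in> \<Union>\<N>"
    proof (rule ccontr)
      assume notin: "A \<notin> \<Union>\<N>"
      have A_ne: "A \<noteq> {}" "A \<noteq> UNIV" using notin by (auto simp: \<N>_def)
      have notN1: "A \<notin> N1 (C, u, n)" if "C \<in> \<C>" "u \<in> D" for C u n
        using notin that by (auto simp: \<N>_def)
      have notN2: "A \<notin> N2 (C, u, m, n)" if "C \<in> \<C>" "u \<in> D" for C u m n
        using notin that by (auto simp: \<N>_def)
      \<comment> \<open>\<open>c\<close> moves \<open>S\<close> into \<open>D\<close>; the last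
        clause is the nearness premise built into \<open>N1\<close> and \<open>N2\<close>.\<close>
      have approx: "\<exists>c. c ` S \<in> \<C> \<and> (\<forall>s\<in>S. dist s (c s) < r n) \<and> (\<forall>v\<in>c ` S. \<exists>a\<in>A. dist v a < r n)"
        if S: "finite S" "S \<noteq> {}" "S \<subseteq> A" for S n
      proof -
        have "\<forall>s\<in>S. \<exists>c. c \<in> D \<and> dist s c < r n" using dense_approx[OF D(2) r] by metis
        then obtain c where c: "\<forall>s\<in>S. c s \<in> D \<and> dist s (c s) < r n" by (rule bchoice[THEN exE])
        then show ?thesis using S by (intro exI[of _ c]) (auto simp: \<C>_def dist_commute)
      qed
      have "approximately_injective A"
        unfolding approximately_injective_def
      proof (intro allI impI, elim conjE)
        fix S u and e :: real assume S: "finite S" "S \<noteq> {}" "S \<subseteq> A" and "0 < e"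
        obtain n where n: "r n < e / 6" using small[of "e / 6"] \<open>0 < e\<close> by auto
        obtain c where c: "c ` S \<in> \<C>" "\<forall>s\<in>S. dist s (c s) < r n" "\<forall>v\<in>c ` S. \<exists>a\<in>A. dist v a < r n"
          using approx[OF S] by blast
        obtain v where v: "v \<in> D" "dist u v < r n" using dense_approx[OF D(2) r] .
        obtain w where w: "w \<in> A" "\<forall>s\<in>S. \<bar>dist w (c s) - dist v (c s)\<bar> < 3 * r n"
          using notN1[OF c(1) v(1), of n] \<open>closed A\<close> c(3) unfolding N1_def by auto
        \<comment> \<open>Besides \<open>3 * r n\<close>, replacing \<open>c s\<close> by
          \<open>s\<close> twice and \<open>v\<close> by \<open>u\<close> once costs
          \<open>r n\<close> each; hence \<open>e / 6\<close>.\<close>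
        have "\<bar>dist w s - dist u s\<bar> < e" if "s \<in> S" for s
          using n v(2) w(2)[rule_format, OF that] c(2)[rule_format, OF that]
            abs_dist_diff_le[of s w "c s"] abs_dist_diff_le[of s v "c s"] abs_dist_diff_le[of u s v]
          by (simp add: dist_commute abs_le_iff abs_less_iff)
        then show "\<exists>w\<in>A. \<forall>s\<in>S. \<bar>dist w s - dist u s\<bar> < e" using w(1) by blast
      qed
      moreover have "\<exists>x k. 0 < k \<and> dist_undetermined A x k"
      proof -
        \<comment> \<open>The complement of \<open>A\<close> is open and nonempty, and the positive
          distance from \<open>x\<close> to \<open>A\<close> leaves room for the gap
          \<open>r m\<close>.\<close>
        obtain x where x: "x \<in> D" "x \<notin> A" using D(2)[of "- A"] A_ne \<open>closed A\<close> by auto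
        have "0 < infdist x A" using infdist_pos_not_in_closed \<open>closed A\<close> A_ne(1) x(2) .
        then obtain m where "r m < infdist x A" using small by blast
        then have m: "\<forall>a\<in>A. r m \<le> dist x a" using infdist_le[of _ A x] by fastforce
        have "dist_undetermined A x (r m)"
          unfolding dist_undetermined_def
        proof (intro allI impI, elim conjE)
          fix S and e :: real assume S: "finite S" "S \<noteq> {}" "S \<subseteq> A" and "0 < e"
          obtain n where n: "r n < e / 6" using small[of "e / 6"] \<open>0 < e\<close> by auto
          obtain c where c: "c ` S \<in> \<C>" "\<forall>s\<in>S. dist s (c s) < r n" "\<forall>v\<in>c ` S. \<exists>a\<in>A. dist v a < r n"
            using approx[OF S] by blast
          obtain w w' where w: "w \<in> A" "w' \<in> A"
            "\<forall>s\<in>S. \<bar>dist w (c s) - dist w' (c s)\<bar> < 4 * r n" "r m - 2 * r n \<le> dist w' x - dist w x"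
            using notN2[OF c(1) x(1), of m n] \<open>closed A\<close> c(3) m unfolding N2_def by auto
          have "\<bar>dist w s - dist w' s\<bar> < e" if "s \<in> S" for s
            using n w(3)[rule_format, OF that] c(2)[rule_format, OF that]
              abs_dist_diff_le[of s w "c s"] abs_dist_diff_le[of s w' "c s"]
            by (simp add: dist_commute abs_le_iff abs_less_iff)
          moreover have "r m - e \<le> dist w' x - dist w x"
            using w(4) n r[of n] by linarith
          ultimately show "\<exists>w\<in>A. \<exists>w'\<in>A. (\<forall>s\<in>S. \<bar>dist w s - dist w' s\<bar> < e) \<and> r m - e \<le> dist w' x - dist w x"
            using w(1,2) by blast
        qed
        then show ?thesis using r by blast
      qed
      ultimately show False using A A_ne \<open>closed A\<close> by blast
    qed
  qed
  then have "meager_in Wijsman (topspace Wijsman - ?G)"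
    using meager_inI[OF \<open>countable \<N>\<close>, of Wijsman "\<lambda>N. N"] nd by simp
  then show ?thesis by (auto simp: comeager_in_def)
qed


section \<open>Exact extension and homogeneity of generic closed sets\<close>

text \<open>Keeping the distances of \<open>u\<close> on \<open>S\<close> and giving
  \<open>a\<close> the largest error \<open>r\<close> as its distance yields a Katetov function on
  \<open>insert a S\<close>.\<close>

lemma Urysohn_correct_point:
  fixes S :: "'a::polish_space set"
  assumes U: "Urysohn_space TYPE('a)" and "finite S" "0 \<le> e"
    and close: "\<And>s. s \<in> S \<Longrightarrow> \<bar>dist a s - dist u s\<bar> \<le> e"
  obtains v where "\<And>s. s \<in> S \<Longrightarrow> dist v s = dist u s" "dist v a \<le> e"
proof (cases "a \<in> S \<or> S = {}")
  case True
  \<comment> \<open>If \<open>a\<close> lies in \<open>S\<close>, the hypothesis at \<open>a\<close>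
    says that \<open>u\<close> is close enough; if \<open>S\<close> is empty, \<open>a\<close>
    itself will do.\<close>
  then show ?thesis using that[of u] that[of a] close[of a] \<open>0 \<le> e\<close> by auto
next
  case False
  define r where "r = Max ((\<lambda>s. \<bar>dist a s - dist u s\<bar>) ` S)"
  have r_ge: "\<bar>dist a s - dist u s\<bar> \<le> r" if "s \<in> S" for s
    using that \<open>finite S\<close> by (simp add: r_def)
  have "r \<in> (\<lambda>s. \<bar>dist a s - dist u s\<bar>) ` S"
    unfolding r_def using False \<open>finite S\<close> by (intro Max_in) auto
  then obtain t where t: "t \<in> S" "r = \<bar>dist a t - dist u t\<bar>" by blast
  \<comment> \<open>\<open>r\<close> is at most the distance from \<open>a\<close> to
    \<open>u\<close>.\<close>
  have r_le: "r \<le> dist a s + dist u s" for s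
    using dist_triangle[of a t s] dist_triangle[of u t s] dist_triangle[of a t u] dist_triangle[of u t a]
      dist_triangle[of a u s]
    unfolding t(2) by (simp add: dist_commute abs_le_iff)
  define p where "p = (\<lambda>y. if y \<in> S then dist u y else r)"
  have "\<bar>p x - p y\<bar> \<le> dist x y" "dist x y \<le> p x + p y" if "x \<in> insert a S" "y \<in> insert a S" for x y
    using that r_le[of x] r_le[of y] r_ge[of x] r_ge[of y] r_ge[OF t(1)] False
      abs_dist_diff_le[of x u y] dist_triangle[of x y u]
    by (auto simp: p_def dist_commute abs_le_iff)
  moreover have "finite (insert a S)" using \<open>finite S\<close> by simp
  ultimately obtain v where v: "\<And>s. s \<in> insert a S \<Longrightarrow> dist v s = p s"
    using Urysohn_one_point_extension[OF U, of "insert a S" p] by metis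
  show ?thesis
  proof (rule that)
    show "dist v s = dist u s" if "s \<in> S" for s using v[of s] that by (simp add: p_def)
    show "dist v a \<le> e" using v[of a] False t close by (simp add: p_def)
  qed
qed

lemma Cauchy_geometric_dist:
  fixes f :: "nat \<Rightarrow> 'a::metric_space"
  assumes "\<And>n. dist (f (Suc n)) (f n) \<le> c * (1/2) ^ n"
  shows "Cauchy f"
proof -
  \<comment> \<open>The subtracted tail makes the induction close.\<close>
  have step: "dist (f n) (f (n + k)) \<le> 2 * c * (1/2) ^ n - 2 * c * (1/2) ^ (n + k)" for n k
  proof (induction k)
    case (Suc k)
    have "dist (f n) (f (n + Suc k)) \<le> dist (f n) (f (n + k)) + dist (f (Suc (n + k))) (f (n + k))"
      by (metis add_Suc_right dist_commute dist_triangle)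
    with Suc assms[of "n + k"] show ?case by simp
  qed simp
  have c: "0 \<le> c" using order_trans[OF zero_le_dist assms[of 0]] by simp
  show ?thesis
  proof (rule metric_CauchyI)
    fix e :: real assume "0 < e"
    have "(\<lambda>n. 2 * c * (1/2) ^ n) \<longlonglongrightarrow> 2 * c * 0"
      by (intro tendsto_mult_left LIMSEQ_power_zero) simp
    then have "\<forall>\<^sub>F n in sequentially. 2 * c * (1/2) ^ n < e / 2"
      using \<open>0 < e\<close> by (intro order_tendstoD(2)[where y = "2 * c * 0"]) auto
    then obtain M where M: "2 * c * (1/2) ^ M < e / 2" by (auto simp: eventually_sequentially)
    have near: "dist (f M) (f n) < e / 2" if "M \<le> n" for n
    proof -
      have "dist (f M) (f n) \<le> 2 * c * (1/2) ^ M - 2 * c * (1/2) ^ n" using step[of M "n - M"] that by simp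
      moreover have "0 \<le> 2 * c * (1/2) ^ n" using c by simp
      ultimately show ?thesis using M by linarith
    qed
    have "dist (f m) (f n) < e" if "M \<le> m" "M \<le> n" for m n
      using near[OF that(1)] near[OF that(2)] dist_triangle3[of "f m" "f n" "f M"] by linarith
    then show "\<exists>M. \<forall>m\<ge>M. \<forall>n\<ge>M. dist (f m) (f n) < e" by blast
  qed
qed

text \<open>Better and better approximate realisations are chosen in \<open>A\<close> close to their
  predecessors; they converge, and the limit is exact and lies in the closed set
  \<open>A\<close>.\<close>

lemma approximately_injective_imp_finitely_injective:
  fixes A :: "'a::polish_space set"
  assumes U: "Urysohn_space TYPE('a)" and A: "closed A" "A \<noteq> {}" "approximately_injective A"
  shows "finitely_injective A"
  unfolding finitely_injective_def
proof (intro allI impI, elim conjE)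
  fix S u assume S: "finite S" "S \<subseteq> A"
  show "\<exists>w\<in>A. \<forall>s\<in>S. dist w s = dist u s"
  proof (cases "S = {}")
    case True
    then show ?thesis using A(2) by blast
  next
    case False
    define P where "P = (\<lambda>n a. a \<in> A \<and> (\<forall>s\<in>S. \<bar>dist a s - dist u s\<bar> < (1/2) ^ n))" for n :: nat
    have "\<exists>f. \<forall>n. P n (f n) \<and> dist (f (Suc n)) (f n) \<le> 2 * (1/2) ^ n"
    proof (rule dependent_nat_choice)
      show "\<exists>a. P 0 a"
        using A(3)[unfolded approximately_injective_def, rule_format, of S 1 u] S False by (auto simp: P_def)
    next
      fix a and n :: nat assume a: "P n a"
      have "0 \<le> (1/2 :: real) ^ n" by simp
      moreover have "\<bar>dist a s - dist u s\<bar> \<le> (1/2) ^ n" if "s \<in> S" for s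
        using a that unfolding P_def by (simp add: less_imp_le)
      ultimately obtain v where v: "\<And>s. s \<in> S \<Longrightarrow> dist v s = dist u s" "dist v a \<le> (1/2) ^ n"
        using Urysohn_correct_point[OF U S(1), of "(1/2) ^ n" a u] by metis
      \<comment> \<open>\<open>v\<close> is exact over \<open>S\<close> but may lie outside
        \<open>A\<close>; including \<open>a\<close> among the parameters keeps its approximation
        \<open>b\<close> near \<open>a\<close>.\<close>
      obtain b where b: "b \<in> A" "\<forall>s\<in>insert a S. \<bar>dist b s - dist v s\<bar> < (1/2) ^ Suc n"
        using A(3)[unfolded approximately_injective_def, rule_format, of "insert a S" "(1/2) ^ Suc n" v] S a
        by (auto simp: P_def)
      have "P (Suc n) b" using b v(1) unfolding P_def by simp
      moreover have "dist b a \<le> 2 * (1/2) ^ n"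
        using b(2)[rule_format, OF insertI1] v(2) zero_le_power[of "1/2 :: real" n]
        unfolding power_Suc by linarith
      ultimately show "\<exists>b. P (Suc n) b \<and> dist b a \<le> 2 * (1/2) ^ n" by blast
    qed
    then obtain f where f: "\<And>n. P n (f n)" "\<And>n. dist (f (Suc n)) (f n) \<le> 2 * (1/2) ^ n" by blast
    have "convergent f" using Cauchy_geometric_dist[OF f(2)] by (rule Cauchy_convergent)
    then obtain w where w: "f \<longlonglongrightarrow> w" by (auto simp: convergent_def)
    have "w \<in> A" using closed_sequentially[OF A(1) _ w] f(1) by (simp add: P_def)
    moreover have "dist w s = dist u s" if "s \<in> S" for s
    proof -
      have "(\<lambda>n. dist (f n) s) \<longlonglongrightarrow> dist w s" by (intro tendsto_intros w)
      moreover have "(\<lambda>n. dist (f n) s) \<longlonglongrightarrow> dist u s"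
      proof (rule LIM_zero_cancel, rule Lim_null_comparison)
        show "(\<lambda>n. (1/2 :: real) ^ n) \<longlonglongrightarrow> 0" by (intro LIMSEQ_power_zero) simp
        show "\<forall>\<^sub>F n in sequentially. norm (dist (f n) s - dist u s) \<le> (1/2) ^ n"
          using f(1) that by (auto simp: P_def less_imp_le intro!: always_eventually)
      qed
      ultimately show ?thesis by (rule LIMSEQ_unique)
    qed
    ultimately show ?thesis by blast
  qed
qed

section \<open>Partial isometries and back and forth\<close>

text \<open>As relations, partial isometries can be inverted and closed topologically; distance
  preservation makes them single valued in both directions.\<close>

definition isometric_rel :: "('a::metric_space \<times> 'b::metric_space) set \<Rightarrow> bool" where
  "isometric_rel R \<longleftrightarrow> (\<forall>p\<in>R. \<forall>q\<in>R. dist (fst p) (fst q) = dist (snd p) (snd q))"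

lemma isometric_relD:
  "isometric_rel R \<Longrightarrow> (a, b) \<in> R \<Longrightarrow> (a', b') \<in> R \<Longrightarrow> dist a a' = dist b b'"
  by (force simp: isometric_rel_def)

lemma isometric_rel_converse: "isometric_rel (R\<inverse>) \<longleftrightarrow> isometric_rel R"
  by (force simp: isometric_rel_def)

lemma isometric_rel_closure:
  assumes "isometric_rel R"
  shows "isometric_rel (closure R)"
proof -
  let ?E = "{z. dist (fst (fst z)) (fst (snd z)) = dist (snd (fst z)) (snd (snd z))}"
  have "closed ?E" by (intro closed_Collect_eq continuous_intros)
  moreover have "R \<times> R \<subseteq> ?E" using isometric_relD[OF assms] by auto
  ultimately have "closure R \<times> closure R \<subseteq> ?E"
    using closure_minimal[of "R \<times> R" ?E] by (simp add: closure_Times)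
  then show ?thesis by (auto simp: isometric_rel_def)
qed

text \<open>The distances from \<open>e\<close> to the domain of \<open>R\<close>, carried over to
  its range, form a Katetov function; it is realised by some \<open>u\<close>, then by a point of
  \<open>A\<close>.\<close>

lemma isometric_rel_extend:
  fixes A :: "'a::polish_space set"
  assumes U: "Urysohn_space TYPE('a)" and A: "finitely_injective A"
    and R: "finite R" "R \<subseteq> A \<times> A" "isometric_rel R"
  obtains b where "b \<in> A" "isometric_rel (insert (e, b) R)"
proof -
  have "\<forall>b\<in>snd ` R. \<exists>a. (a, b) \<in> R" by auto
  then obtain g where g: "\<forall>b\<in>snd ` R. (g b, b) \<in> R" by (rule bchoice[THEN exE])
  have dist_g: "dist b b' = dist (g b) (g b')" if "b \<in> snd ` R" "b' \<in> snd ` R" for b b'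
    using isometric_relD[OF R(3)] g that by metis
  have "finite (snd ` R)" using R(1) by simp
  moreover have "\<bar>dist e (g b) - dist e (g b')\<bar> \<le> dist b b'" "dist b b' \<le> dist e (g b) + dist e (g b')"
    if "b \<in> snd ` R" "b' \<in> snd ` R" for b b'
    using dist_g[OF that] abs_dist_diff_le[of "g b" e "g b'"] dist_triangle3[of "g b" "g b'" e]
    by (simp_all add: dist_commute)
  ultimately obtain u where u: "\<And>b. b \<in> snd ` R \<Longrightarrow> dist u b = dist e (g b)"
    using Urysohn_one_point_extension[OF U, of "snd ` R" "\<lambda>b. dist e (g b)"] by metis
  obtain w where w: "w \<in> A" "\<forall>b\<in>snd ` R. dist w b = dist u b"
    using A[unfolded finitely_injective_def, rule_format, of "snd ` R" u] R(1,2) by fastforce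
  have new: "dist e a = dist w b" if "(a, b) \<in> R" for a b
  proof -
    have b: "b \<in> snd ` R" using that by force
    \<comment> \<open>This distance is zero, so the chosen preimage \<open>g b\<close> is
      \<open>a\<close>.\<close>
    have "dist a (g b) = dist b b" using isometric_relD[OF R(3) that] g b by blast
    then show ?thesis using w(2)[rule_format, OF b] u[OF b] by simp
  qed
  have "isometric_rel (insert (e, w) R)"
    using new R(3) unfolding isometric_rel_def by (force simp: dist_commute)
  with w(1) show ?thesis by (rule that)
qed

text \<open>Partners of a convergent sequence form a Cauchy sequence, and its limit is a partner of
  the limit point.\<close>

lemma isometric_rel_complete_Domain:
  fixes H :: "('a::metric_space \<times> 'b::complete_space) set"
  assumes H: "isometric_rel H" and E: "E \<subseteq> Domain H" "a \<in> closure E"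
    and lim: "\<And>f g a b. (\<And>n. (f n, g n) \<in> H) \<Longrightarrow> f \<longlonglongrightarrow> a \<Longrightarrow> g \<longlonglongrightarrow> b \<Longrightarrow> (a, b) \<in> H"
  shows "a \<in> Domain H"
proof -
  obtain f where f: "\<And>n. f n \<in> E" "f \<longlonglongrightarrow> a" using E(2) by (auto simp: closure_sequential)
  then have "\<forall>n. \<exists>b. (f n, b) \<in> H" using E(1) by blast
  then obtain g where g: "\<And>n. (f n, g n) \<in> H" by metis
  have "Cauchy f" using f(2) by (rule LIMSEQ_imp_Cauchy)
  then have "Cauchy g" unfolding Cauchy_def by (simp add: isometric_relD[OF H g g])
  then obtain b where "g \<longlonglongrightarrow> b" using Cauchy_convergent convergent_def by blast
  with lim[OF g f(2)] show ?thesis by blast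
qed

text \<open>Back and forth along a dense sequence; the closure of the resulting relation is the graph
  of the isometry.\<close>

lemma finitely_injective_homogeneous:
  fixes A :: "'a::polish_space set"
  assumes U: "Urysohn_space TYPE('a)" and A: "closed A" "A \<noteq> {}" "finitely_injective A"
    and R: "finite R" "R \<subseteq> A \<times> A" "isometric_rel R"
  obtains h where "h \<in> Iso A A" "\<And>a b. (a, b) \<in> R \<Longrightarrow> h a = b"
proof -
  obtain E where E: "countable E" "E \<subseteq> A" "A \<subseteq> closure E" using separable[of A] .
  have "E \<noteq> {}" using E(3) A(2) by auto
  define en where "en = from_nat_into E"
  have range_en: "range en = E" using range_from_nat_into[OF \<open>E \<noteq> {}\<close> E(1)] by (simp add: en_def)
  define P where "P = (\<lambda>T. finite T \<and> T \<subseteq> A \<times> A \<and> isometric_rel T \<and> R \<subseteq> T)"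
  have "\<exists>f. \<forall>n::nat. P (f n) \<and> (f n \<subseteq> f (Suc n) \<and> en n \<in> Domain (f (Suc n)) \<and> en n \<in> Range (f (Suc n)))"
  proof (rule dependent_nat_choice)
    show "\<exists>T. P T" using R unfolding P_def by blast
  next
    fix T and n :: nat assume "P T"
    then have T: "finite T" "T \<subseteq> A \<times> A" "isometric_rel T" "R \<subseteq> T" by (auto simp: P_def)
    have e: "en n \<in> A" using range_en E(2) by blast
    obtain b where b: "b \<in> A" "isometric_rel (insert (en n, b) T)"
      by (rule isometric_rel_extend[OF U A(3) T(1-3)])
    let ?T = "insert (en n, b) T"
    \<comment> \<open>The back step is the forth step for the converse relation.\<close>
    have T': "finite (?T\<inverse>)" "?T\<inverse> \<subseteq> A \<times> A" "isometric_rel (?T\<inverse>)"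
      using T b e isometric_rel_converse by auto
    obtain a where a: "a \<in> A" "isometric_rel (insert (en n, a) (?T\<inverse>))"
      by (rule isometric_rel_extend[OF U A(3) T'])
    have "insert (en n, a) (?T\<inverse>) = (insert (a, en n) ?T)\<inverse>" by auto
    with a(2) have "isometric_rel (insert (a, en n) ?T)" by (simp only: isometric_rel_converse)
    then have "P (insert (a, en n) ?T)" using T a b e by (auto simp: P_def)
    then show "\<exists>T'. P T' \<and> (T \<subseteq> T' \<and> en n \<in> Domain T' \<and> en n \<in> Range T')" by blast
  qed
  then obtain f where f: "\<And>n::nat. P (f n)" "\<And>n. f n \<subseteq> f (Suc n)"
    "\<And>n. en n \<in> Domain (f (Suc n))" "\<And>n. en n \<in> Range (f (Suc n))" by blast
  have mono: "f m \<subseteq> f n" if "m \<le> n" for m n using lift_Suc_mono_le[of f, OF f(2) that] .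
  define T where "T = (\<Union>n. f n)"
  have T: "T \<subseteq> A \<times> A" "R \<subseteq> T" using f(1) unfolding T_def P_def by blast+
  have "isometric_rel T"
    unfolding isometric_rel_def
  proof (intro ballI)
    fix p q assume "p \<in> T" "q \<in> T"
    then obtain m n where "p \<in> f m" "q \<in> f n" by (auto simp: T_def)
    then have "p \<in> f (max m n)" "q \<in> f (max m n)"
      using mono[of m "max m n"] mono[of n "max m n"] by auto
    then show "dist (fst p) (fst q) = dist (snd p) (snd q)"
      using f(1)[of "max m n"] by (auto simp: P_def isometric_rel_def)
  qed
  define H where "H = closure T"
  have H: "isometric_rel H" unfolding H_def by (rule isometric_rel_closure) fact
  have HA: "H \<subseteq> A \<times> A" unfolding H_def by (intro closure_minimal T(1) closed_Times A(1))
  have TH: "T \<subseteq> H" unfolding H_def by (rule closure_subset)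
  have lim: "(a, b) \<in> H" if "\<And>n. (f n, g n) \<in> H" "f \<longlonglongrightarrow> a" "g \<longlonglongrightarrow> b" for f g a b
    using closed_sequentially[of H "\<lambda>n. (f n, g n)"] that by (auto simp: H_def intro: tendsto_Pair)
  have ED: "E \<subseteq> Domain H" "E \<subseteq> Domain (H\<inverse>)"
    using f(3,4) TH unfolding range_en[symmetric] T_def by blast+
  have dom: "a \<in> Domain H" if "a \<in> A" for a
  proof (rule isometric_rel_complete_Domain[OF H ED(1)])
    show "a \<in> closure E" using that E(3) by blast
  qed (rule lim)
  have H': "isometric_rel (H\<inverse>)" using H by (simp only: isometric_rel_converse)
  have "a \<in> Domain (H\<inverse>)" if "a \<in> A" for a
  proof (rule isometric_rel_complete_Domain[OF H' ED(2)])
    show "a \<in> closure E" using that E(3) by blast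
  next
    fix f g a b assume "\<And>n. (f n, g n) \<in> H\<inverse>" "f \<longlonglongrightarrow> a" "g \<longlonglongrightarrow> b"
    then show "(a, b) \<in> H\<inverse>" using lim[of g f b a] by simp
  qed
  then have ran: "a \<in> Range H" if "a \<in> A" for a using that by blast
  define h where "h = restrict (\<lambda>a. SOME b. (a, b) \<in> H) A"
  have h: "(a, h a) \<in> H" if "a \<in> A" for a
    using dom[OF that] someI_ex[of "\<lambda>b. (a, b) \<in> H"] that by (auto simp: h_def)
  have h_eq: "h a = b" if "(a, b) \<in> H" for a b
  proof -
    have "a \<in> A" using that HA by blast
    then show ?thesis using isometric_relD[OF H h[OF \<open>a \<in> A\<close>] that] by simp
  qed
  show ?thesis
  proof (rule that)
    show "h a = b" if "(a, b) \<in> R" for a b using h_eq that T(2) TH by blast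
    have dist_h: "dist (h x) (h y) = dist x y" if "x \<in> A" "y \<in> A" for x y
      using isometric_relD[OF H h[OF that(1)] h[OF that(2)]] by simp
    have "inj_on h A" by (rule inj_onI) (metis dist_h dist_eq_0_iff)
    moreover have "h ` A = A"
    proof
      show "h ` A \<subseteq> A" using h HA by blast
      show "A \<subseteq> h ` A" using ran h_eq HA by blast
    qed
    ultimately show "h \<in> Iso A A"
      using dist_h by (simp add: Iso_def bij_betw_def h_def)
  qed
qed

text \<open>The point \<open>w'\<close>, whose distances to \<open>S\<close> are nearly those of
  \<open>w\<close>, is corrected to a nearby \<open>z\<close> in \<open>A\<close> with exactly those
  distances. Homogeneity then gives an isometry fixing \<open>S\<close> and taking \<open>w\<close>
  to \<open>z\<close>.\<close>

lemma dist_undetermined_isometry: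
  fixes A :: "'a::polish_space set"
  assumes U: "Urysohn_space TYPE('a)" and A: "closed A" "A \<noteq> {}" "finitely_injective A"
    and gap: "0 < k" "dist_undetermined A x k" and S: "finite S" "S \<subseteq> A"
  obtains h z where "h \<in> Iso A A" "z \<in> A" "\<And>s. s \<in> S \<Longrightarrow> h s = s"
    "k / 2 < \<bar>dist x z - dist x (h z)\<bar>"
proof -
  obtain a0 where "a0 \<in> A" using A(2) by blast
  \<comment> \<open>\<open>dist_undetermined\<close> speaks of nonempty sets only, whereas
    \<open>S\<close> may be empty.\<close>
  let ?S = "insert a0 S"
  have S': "finite ?S" "?S \<noteq> {}" "?S \<subseteq> A" using S \<open>a0 \<in> A\<close> by auto
  have "0 < k / 5" using gap(1) by simp
  then obtain w w' where w: "w \<in> A" "w' \<in> A" "\<forall>s\<in>?S. \<bar>dist w s - dist w' s\<bar> < k / 5"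
    "k - k / 5 \<le> dist w' x - dist w x"
    using gap(2)[unfolded dist_undetermined_def, rule_format, of ?S "k / 5"] S' by blast
  have "\<bar>dist w' s - dist w s\<bar> \<le> k / 5" if "s \<in> S" for s
    using w(3) that by (simp add: abs_minus_commute less_imp_le)
  then obtain v where v: "\<And>s. s \<in> S \<Longrightarrow> dist v s = dist w s" "dist v w' \<le> k / 5"
    using Urysohn_correct_point[OF U S(1) less_imp_le[OF \<open>0 < k / 5\<close>], of w' w] by metis
  obtain z where z: "z \<in> A" "\<forall>s\<in>insert w' S. dist z s = dist v s"
    using A(3)[unfolded finitely_injective_def, rule_format, of "insert w' S" v] S w(2) by auto
  have "isometric_rel (insert (w, z) (Id_on S))"
    using z(2) v(1) by (auto simp: isometric_rel_def Id_on_def dist_commute)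
  moreover have "finite (insert (w, z) (Id_on S))" "insert (w, z) (Id_on S) \<subseteq> A \<times> A"
    using S w(1) z(1) by (auto simp: Id_on_def)
  ultimately obtain h where h: "h \<in> Iso A A" "\<forall>a b. (a, b) \<in> insert (w, z) (Id_on S) \<longrightarrow> h a = b"
    using finitely_injective_homogeneous[OF U A, of "insert (w, z) (Id_on S)"] by metis
  show ?thesis
  proof (rule that[OF h(1) w(1)])
    show "h s = s" if "s \<in> S" for s using h(2) that by blast
    have "h w = z" using h(2) by blast
    moreover have "dist z w' \<le> k / 5" using z(2) v(2) by simp
    \<comment> \<open>Of the gap \<open>k\<close>, one fifth is lost to the tolerance and one to the
      correction; \<open>3 * k / 5\<close> remains.\<close>
    ultimately show "k / 2 < \<bar>dist x w - dist x (h w)\<bar>"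
      using w(4) abs_dist_diff_le[of z w' x] abs_dist_diff_le[of x w' z] gap(1)
        dist_triangle3[of w' x z] by (simp add: dist_commute)
  qed
qed


section \<open>Extendable isometries\<close>

text \<open>An extension \<open>g\<close> of \<open>f\<close> turns the distance function of \<open>x\<close> on \<open>A\<close> into that of \<open>g x\<close>,
  hence, up to \<open>e\<close>, into that of one of countably many points \<open>y\<close>.\<close>

lemma meager_extendable:
  fixes A B :: "'a::polish_space set"
  assumes "0 < e"
    and move: "\<And>S. finite S \<Longrightarrow> S \<subseteq> A \<Longrightarrow> \<exists>h\<in>Iso A A. \<exists>z\<in>A. (\<forall>s\<in>S. h s = s) \<and>
                 2 * e < \<bar>dist x z - dist x (h z)\<bar>"
  shows "meager_in (Iso_topology A B) {f \<in> Iso A B. extends_to_isometry A f}"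
proof -
  obtain D :: "'a set" where D: "countable D" "\<And>X. open X \<Longrightarrow> X \<noteq> {} \<Longrightarrow> \<exists>d\<in>D. d \<in> X"
    by (rule countable_dense_setE) blast
  define N where "N = (\<lambda>y. {f \<in> Iso A B. \<forall>a\<in>A. \<bar>dist x a - dist y (f a)\<bar> \<le> e})"
  have "nowhere_dense_in (Iso_topology A B) (N y)" for y
  proof (rule nowhere_dense_inI)
    show "N y \<subseteq> topspace (Iso_topology A B)" by (auto simp: N_def)
  next
    fix W f assume W: "openin (Iso_topology A B) W" "f \<in> W" and f: "f \<in> N y"
    obtain O' where O': "openin (product_topology (\<lambda>_. euclidean) A) O'" "W = O' \<inter> Iso A B"
      using W(1) unfolding Iso_topology_def openin_subtopology by blast
    have "f \<in> O'" using W(2) O'(2) by blast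
    obtain X where X: "f \<in> Pi\<^sub>E A X" "finite {i. X i \<noteq> (UNIV :: 'a set)}" "Pi\<^sub>E A X \<subseteq> O'"
      using product_topology_open_contains_basis[OF O'(1) \<open>f \<in> O'\<close>] by auto
    \<comment> \<open>A basic neighbourhood restricts only these coordinates, and composing
      \<open>f\<close> with an \<open>h\<close> that fixes them stays inside it.\<close>
    define S where "S = {i. X i \<noteq> UNIV} \<inter> A"
    obtain h z where h: "h \<in> Iso A A" "z \<in> A" "\<forall>s\<in>S. h s = s" "2 * e < \<bar>dist x z - dist x (h z)\<bar>"
      using move[of S] X(2) unfolding S_def by blast
    have hA: "h a \<in> A" if "a \<in> A" for a using h(1) that by (auto simp: Iso_def bij_betw_def)
    define f' where "f' = restrict (f \<circ> h) A"
    have "bij_betw (f \<circ> h) A B"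
      using h(1) f by (auto simp: Iso_def N_def intro: bij_betw_trans)
    then have "f' \<in> Iso A B"
      using h(1) f hA by (simp add: Iso_def N_def f'_def)
    moreover have "f' \<in> Pi\<^sub>E A X"
    proof
      show "f' a \<in> X a" if "a \<in> A" for a
      proof (cases "a \<in> S")
        case True
        then show ?thesis using h(3) X(1) that by (auto simp: f'_def)
      next
        case False
        then show ?thesis using that by (auto simp: S_def)
      qed
    qed (simp add: f'_def)
    ultimately have "f' \<in> W" using X(3) O'(2) by blast
    let ?V = "{g \<in> topspace (Iso_topology A B). g z \<in> {v. e < \<bar>dist x z - dist y v\<bar>}}"
    have "continuous_map (Iso_topology A B) euclidean (\<lambda>g. g z)"
      unfolding Iso_topology_def
      by (intro continuous_map_from_subtopology continuous_map_product_projection h(2))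
    moreover have "open {v. e < \<bar>dist x z - dist y v\<bar>}"
      by (intro open_Collect_less continuous_intros)
    ultimately have "openin (Iso_topology A B) ?V"
      by (intro openin_continuous_map_preimage) auto
    moreover have "f' \<in> ?V"
    proof -
      \<comment> \<open>The estimate for \<open>f\<close> at \<open>h z\<close> and the gap
        \<open>2 * e\<close> together refute the estimate for \<open>f'\<close> at
        \<open>z\<close>.\<close>
      have "\<bar>dist x (h z) - dist y (f (h z))\<bar> \<le> e" using f hA[OF h(2)] by (simp add: N_def)
      then have "e < \<bar>dist x z - dist y (f (h z))\<bar>" using h(4) by linarith
      then show ?thesis using \<open>f' \<in> Iso A B\<close> h(2) by (simp add: f'_def)
    qed
    moreover have "?V \<inter> N y = {}" using h(2) by (force simp: N_def)
    ultimately show "\<exists>V. openin (Iso_topology A B) V \<and> V \<inter> W \<noteq> {} \<and> V \<inter> N y = {}"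
      using \<open>f' \<in> W\<close> by (intro exI[of _ ?V]) blast
  qed
  moreover have "{f \<in> Iso A B. extends_to_isometry A f} \<subseteq> (\<Union>y\<in>D. N y)"
  proof
    fix f assume "f \<in> {f \<in> Iso A B. extends_to_isometry A f}"
    then obtain g where f: "f \<in> Iso A B" and g: "g \<in> Iso UNIV UNIV" "\<forall>a\<in>A. g a = f a"
      by (auto simp: extends_to_isometry_def)
    obtain y where y: "y \<in> D" "dist (g x) y < e" using dense_approx[OF D(2) \<open>0 < e\<close>] .
    have "\<bar>dist x a - dist y (f a)\<bar> \<le> e" if "a \<in> A" for a
    proof -
      have "dist x a = dist (g x) (g a)" using g(1) by (simp add: Iso_def)
      then have "dist x a = dist (g x) (f a)" using g(2) that by simp
      then show ?thesis using abs_dist_diff_le[of "g x" "f a" y] y(2) by (simp add: dist_commute)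
    qed
    then show "f \<in> (\<Union>y\<in>D. N y)" using f y(1) by (auto simp: N_def)
  qed
  ultimately show ?thesis using meager_inI[OF D(1)] by blast
qed

theorem theorem5p9:
  assumes "Urysohn_space TYPE('a::polish_space)"
  shows "(\<exists>\<G> :: 'a set set. comeager_in Wijsman \<G> \<and>
            (\<forall>F\<in>\<G>. meager_in (Iso_topology F F)
                       {f \<in> Iso F F. extends_to_isometry F f})) \<and>
         (\<exists>\<G>\<^sub>2 :: ('a set \<times> 'a set) set. comeager_in (prod_topology Wijsman Wijsman) \<G>\<^sub>2 \<and>
            (\<forall>(A, B)\<in>\<G>\<^sub>2. meager_in (Iso_topology A B)
                       {f \<in> Iso A B. extends_to_isometry A f}))"
proof -
  let ?G = "{A :: 'a set. closed A \<and> A \<noteq> {} \<and> approximately_injective A \<and>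
              (\<exists>x k. 0 < k \<and> dist_undetermined A x k)}"
  have meager: "meager_in (Iso_topology A B) {f \<in> Iso A B. extends_to_isometry A f}"
    if G: "A \<in> ?G" for A B
  proof -
    obtain x k where A: "closed A" "A \<noteq> {}" "approximately_injective A"
      and k: "0 < k" "dist_undetermined A x k"
      using G by blast
    note inj = approximately_injective_imp_finitely_injective[OF assms A]
    have "\<exists>h\<in>Iso A A. \<exists>z\<in>A. (\<forall>s\<in>S. h s = s) \<and> 2 * (k / 4) < \<bar>dist x z - dist x (h z)\<bar>"
      if S: "finite S" "S \<subseteq> A" for S
    proof -
      obtain h z where "h \<in> Iso A A" "z \<in> A" "\<And>s. s \<in> S \<Longrightarrow> h s = s"
        "k / 2 < \<bar>dist x z - dist x (h z)\<bar>"
        by (rule dist_undetermined_isometry[OF assms A(1,2) inj k S]) (rule that)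
      then show ?thesis by (intro bexI[of _ h] bexI[of _ z]) auto
    qed
    with k(1) show ?thesis by (intro meager_extendable[of "k / 4"]) simp_all
  qed
  \<comment> \<open>\<open>meager\<close> holds for every \<open>B\<close>, so only the first
    coordinate has to be generic.\<close>
  have "comeager_in (prod_topology Wijsman Wijsman) (?G \<times> topspace Wijsman)"
    by (intro comeager_in_Times_topspace comeager_generic assms)
  then show ?thesis using comeager_generic[OF assms] meager by blast
qed

end
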